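(* Let $X$ be a Lindelöf space and let $\kappa<\mathfrak{d}$ be a cardinal. If $X$ is a union of $\kappa$ many $H$-closed subspaces, then $X$ is almost Scheepers.
   Context: Lindelöf means that every open cover has a countable subcover (no separation axiom is assumed). A space is $H$-closed if each of its open covers contains a finite subfamily whose union is dense in the space. $X$ is almost Scheepers if for every sequence $(\mathcal{U}_n)_{n\in\mathbb{N}}$ of open covers of $X$ there are finite $\mathcal{V}_n\subseteq\mathcal{U}_n$ such that every finite set $F\subseteq X$ is contained in $\overline{\bigcup\mathcal{V}_n}$ for some $n$. For $f,g\in\mathbb{N}^{\mathbb{N}}$ write $f\leq^* g$ if $f(n)\leq g(n)$ for all but finitely many $n$. A set $D\subseteq\mathbb{N}^{\mathbb{N}}$ is dominating if for each $g\in\mathbb{N}^{\mathbb{N}}$ there is $f\in D$ with $g\leq^* f$; $\mathfrak{d}$ is the minimum cardinality of a dominating subset of $\mathbb{N}^{\mathbb{N}}$. *)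

theory Defs
  imports "HOL-Analysis.Analysis"
begin

unbundle cardinal_syntax

definition open_cover :: "'a topology \<Rightarrow> 'a set set \<Rightarrow> bool" where
  "open_cover X \<U> \<longleftrightarrow> (\<forall>U\<in>\<U>. openin X U) \<and> \<Union>\<U> = topspace X"

text \<open>In contrast to a common convention, H-closed spaces are not required to be Hausdorff.\<close>

definition H_closed_space :: "'a topology \<Rightarrow> bool" where
  "H_closed_space X \<longleftrightarrow>
     (\<forall>\<U>. open_cover X \<U> \<longrightarrow>
        (\<exists>\<V>. finite \<V> \<and> \<V> \<subseteq> \<U> \<and> X closure_of (\<Union>\<V>) = topspace X))"

definition almost_Scheepers :: "'a topology \<Rightarrow> bool" where
  "almost_Scheepers X \<longleftrightarrow>
     (\<forall>\<U> :: nat \<Rightarrow> 'a set set. (\<forall>n. open_cover X (\<U> n)) \<longrightarrow>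
        (\<exists>\<V>. (\<forall>n. finite (\<V> n) \<and> \<V> n \<subseteq> \<U> n) \<and>
             (\<forall>F. finite F \<and> F \<subseteq> topspace X \<longrightarrow> (\<exists>n. F \<subseteq> X closure_of (\<Union>(\<V> n))))))"

definition le_star :: "(nat \<Rightarrow> nat) \<Rightarrow> (nat \<Rightarrow> nat) \<Rightarrow> bool" (infix \<open>\<le>\<^sup>*\<close> 50) where
  "f \<le>\<^sup>* g \<longleftrightarrow> (\<forall>\<^sub>\<infinity>n. f n \<le> g n)"

definition dominating :: "(nat \<Rightarrow> nat) set \<Rightarrow> bool" where
  "dominating D \<longleftrightarrow> (\<forall>g. \<exists>f\<in>D. g \<le>\<^sup>* f)"

text \<open>
  Cardinals are well-order relations taken up to order isomorphism, so the minimum cardinality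
  is the cardinal of some dominating set of least cardinality; the choice of that set is
  irrelevant up to isomorphism, and the two lemmas below show that it exists.
\<close>

definition dominating_number :: "(nat \<Rightarrow> nat) rel" (\<open>\<dd>\<close>) where
  "\<dd> = |SOME D. dominating D \<and> (\<forall>E. dominating E \<longrightarrow> |D| \<le>o |E| )|"

lemma ex_least_dominating:
  "\<exists>D. dominating D \<and> (\<forall>E. dominating E \<longrightarrow> |D| \<le>o |E| )"
proof -
  let ?R = "card_of ` Collect dominating"
  have "dominating UNIV"
    unfolding dominating_def le_star_def by (metis (mono_tags) UNIV_I MOST_I order_refl)
  then have "?R \<noteq> {}"
    by blast
  moreover have "\<forall>r\<in>?R. Card_order r"
    by (auto simp: card_of_Card_order)
  ultimately have "\<exists>r\<in>?R. \<forall>r'\<in>?R. r \<le>o r'"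
    by (rule exists_minim_Card_order)
  then show ?thesis
    by blast
qed

lemma dominating_number_attained: "\<exists>D. dominating D \<and> \<dd> = |D|"
  unfolding dominating_number_def using someI_ex[OF ex_least_dominating] by blast

lemma dominating_number_least: "dominating E \<Longrightarrow> \<dd> \<le>o |E|"
  unfolding dominating_number_def using someI_ex[OF ex_least_dominating] by blast

end

(* Enumerate a countable subcover of each cover U_n. On the H-closed piece H_i a finite initial
   segment of the enumeration, of length f_i(n) say, is already dense. The pointwise sums of the
   f_i over finite sets of indices i bound all summands and, when there are infinitely many i,
   form a family of fewer than \<dd> functions, hence not a dominating one; a
   function g it fails to dominate tells how many members of U_n to select. *)

theory Submission
  imports Defs "HOL-Algebra.Free_Abelian_Groups"
begin

text \<open>The traces \<open>S \<inter> U m\<close> cover the subspace, so H-closedness leaves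
  finitely many of them with dense union, and their indices have a common bound \<open>k\<close>.
  Closures in the subspace lie inside closures in \<open>X\<close>, which carries the density
  over.\<close>

lemma H_closed_space_initial_segment_dense:
  fixes U :: "nat \<Rightarrow> 'a set"
  assumes H: "H_closed_space (subtopology X S)" and S: "S \<subseteq> topspace X"
    and op: "\<And>m. openin X (U m)" and cov: "S \<subseteq> (\<Union>m. U m)"
  shows "\<exists>k. S \<subseteq> X closure_of (\<Union>m\<le>k. U m)"
proof -
  let ?Y = "subtopology X S"
  have top: "topspace ?Y = S"
    using S by (auto simp: topspace_subtopology)
  have "open_cover ?Y (range (\<lambda>m. S \<inter> U m))"
    unfolding open_cover_def top using cov op
    by (auto intro: openin_subtopology_Int2)
  from H[unfolded H_closed_space_def top, rule_format, OF this]
  obtain \<V> where \<V>: "finite \<V>" "\<V> \<subseteq> range (\<lambda>m. S \<inter> U m)"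
      and dense: "?Y closure_of (\<Union>\<V>) = S"
    by (elim exE conjE)
  obtain M where M: "finite M" "\<V> = (\<lambda>m. S \<inter> U m) ` M"
    using finite_subset_image[OF \<V>] by blast
  obtain k where "M \<subseteq> {..k}"
    using M(1) finite_nat_iff_bounded_le by blast
  then have "\<Union>\<V> \<subseteq> (\<Union>m\<le>k. U m)"
    unfolding M(2) by blast
  then have "S \<subseteq> X closure_of (\<Union>m\<le>k. U m)"
    using dense closure_of_subtopology_subset[of X S "\<Union>\<V>"]
      closure_of_mono[of "\<Union>\<V>" "\<Union>m\<le>k. U m" X] by blast
  then show ?thesis ..
qed

text \<open>One \<open>g\<close> serves every finite \<open>A\<close>, while \<open>n\<close> may
  depend on \<open>A\<close>; this is the order of quantifiers in the Scheepers property, where the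
  selection is fixed before the finite set of points.\<close>

lemma ex_bounds_finite_families_somewhere:
  fixes f :: "'k \<Rightarrow> nat \<Rightarrow> nat"
  assumes small: "|I| <o \<dd>"
  shows "\<exists>g. \<forall>A. finite A \<and> A \<subseteq> I \<longrightarrow> (\<exists>n. \<forall>i\<in>A. f i n \<le> g n)"
proof (cases "finite I")
  case True
  \<comment> \<open>Finite \<open>I\<close> is treated apart because \<open>Fpow I\<close> then
    outnumbers \<open>I\<close>; here the single sum over all of \<open>I\<close> is a bound at
    every \<open>n\<close>.\<close>
  have "f i n \<le> (\<Sum>j\<in>I. f j n)" if "i \<in> I" for i n
    using True that by (intro member_le_sum[where f = "\<lambda>j. f j n"]) auto
  then show ?thesis
    by (intro exI[of _ "\<lambda>n. \<Sum>j\<in>I. f j n"]) blast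
next
  case False
  define F where "F A = (\<lambda>n. \<Sum>i\<in>A. f i n)" for A
  \<comment> \<open>An infinite set has only as many finite subsets as elements, so there are still
    fewer than \<open>\<dd>\<close> sums.\<close>
  have "|Fpow I| =o |I|"
    using eqpoll_Fpow[OF False] unfolding eqpoll_def card_of_ordIso .
  then have "|F ` Fpow I| <o \<dd>"
    using ordLeq_ordLess_trans[OF card_of_image ordIso_ordLess_trans[OF _ small]] by blast
  then have "\<not> dominating (F ` Fpow I)"
    using dominating_number_least not_ordLess_ordLeq by blast
  then obtain g where g: "\<And>A. A \<in> Fpow I \<Longrightarrow> \<not> g \<le>\<^sup>* F A"
    unfolding dominating_def by blast
  have "\<exists>n. \<forall>i\<in>A. f i n \<le> g n" if A: "finite A" "A \<subseteq> I" for A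
  proof -
    \<comment> \<open>Failure of \<open>g \<le>\<^sup>* F A\<close> yields infinitely many such
      \<open>n\<close>; one suffices.\<close>
    obtain n where "F A n < g n"
      using g[of A] A unfolding Fpow_def le_star_def
      by (metis (mono_tags, lifting) ALL_MOST mem_Collect_eq not_le)
    moreover have "f i n \<le> F A n" if "i \<in> A" for i
      unfolding F_def using A(1) that by (intro member_le_sum[where f = "\<lambda>j. f j n"]) auto
    ultimately have "\<forall>i\<in>A. f i n \<le> g n"
      using le_trans less_imp_le by blast
    then show ?thesis ..
  qed
  then show ?thesis by blast
qed

theorem corollary3p4:
  fixes X :: "'a topology" and \<kappa> :: "'k rel" and H :: "'k \<Rightarrow> 'a set"
  assumes "Lindelof_space X"
    and "Card_order \<kappa>" and "\<kappa> <o \<dd>"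
    and "\<And>i. i \<in> Field \<kappa> \<Longrightarrow> H i \<subseteq> topspace X"
    and "\<And>i. i \<in> Field \<kappa> \<Longrightarrow> H_closed_space (subtopology X (H i))"
    and "topspace X = (\<Union>i\<in>Field \<kappa>. H i)"
  shows "almost_Scheepers X"
proof (cases "topspace X = {}")
  case True
  then show ?thesis
    unfolding almost_Scheepers_def by (auto intro!: exI[of _ "\<lambda>_. {}"])
next
  case False
  show ?thesis
    unfolding almost_Scheepers_def
  proof (intro allI impI)
    fix \<U> :: "nat \<Rightarrow> 'a set set"
    assume \<U>: "\<forall>n. open_cover X (\<U> n)"
    have "\<exists>\<W>. countable \<W> \<and> \<W> \<subseteq> \<U> n \<and> \<Union>\<W> = topspace X" for n
      using \<U> assms(1) unfolding open_cover_def by (intro Lindelof_spaceD) auto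
    then obtain \<W> where \<W>: "\<And>n. countable (\<W> n)" "\<And>n. \<W> n \<subseteq> \<U> n"
        "\<And>n. \<Union>(\<W> n) = topspace X"
      by metis
    define U where "U n = from_nat_into (\<W> n)" for n
    \<comment> \<open>\<open>from_nat_into\<close> has range exactly \<open>\<W> n\<close> only if
      this set is nonempty, hence the separate case of the empty space. A finite
      \<open>\<W> n\<close> is enumerated with repetitions.\<close>
    have "\<W> n \<noteq> {}" for n
    proof
      assume "\<W> n = {}"
      then have "topspace X = {}"
        unfolding \<W>(3)[of n, symmetric] by (rule ssubst) (rule Union_empty)
      with False show False by (rule notE)
    qed
    then have range_U: "range (U n) = \<W> n" for n
      unfolding U_def using \<W>(1) by (rule range_from_nat_into)
    have U_in: "U n m \<in> \<U> n" for n m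
      using range_U \<W>(2) by blast
    then have U_open: "openin X (U n m)" for n m
      using \<U> unfolding open_cover_def by blast
    have "\<exists>k. H i \<subseteq> X closure_of (\<Union>m\<le>k. U n m)" if "i \<in> Field \<kappa>" for i n
    proof (rule H_closed_space_initial_segment_dense)
      show "H i \<subseteq> (\<Union>m. U n m)"
        using assms(4)[OF that] unfolding range_U \<W>(3) .
    qed (use that assms(4,5) U_open in blast)+
    then obtain f where f: "\<And>i n. i \<in> Field \<kappa> \<Longrightarrow> H i \<subseteq> X closure_of (\<Union>m\<le>f i n. U n m)"
      by metis
    have "|Field \<kappa>| <o \<dd>"
      by (rule ordIso_ordLess_trans[OF card_of_Field_ordIso[OF assms(2)] assms(3)])
    from ex_bounds_finite_families_somewhere[OF this, of f]
    obtain g where g: "\<forall>A. finite A \<and> A \<subseteq> Field \<kappa> \<longrightarrow> (\<exists>n. \<forall>i\<in>A. f i n \<le> g n)" ..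
    define \<V> where "\<V> n = U n ` {..g n}" for n
    have "\<exists>n. F \<subseteq> X closure_of (\<Union>(\<V> n))" if F: "finite F" "F \<subseteq> topspace X" for F
    proof -
      have "\<forall>x\<in>F. \<exists>i\<in>Field \<kappa>. x \<in> H i"
        using F(2) assms(6) by blast
      \<comment> \<open>Choosing one piece for each point turns the finite set of points into a
        finite set of indices, so that a single \<open>n\<close> works for all of
        \<open>F\<close>.\<close>
      then obtain c where c: "\<And>x. x \<in> F \<Longrightarrow> c x \<in> Field \<kappa> \<and> x \<in> H (c x)"
        by metis
      have "finite (c ` F)" "c ` F \<subseteq> Field \<kappa>"
        using F(1) c by auto
      then obtain n where n: "\<And>x. x \<in> F \<Longrightarrow> f (c x) n \<le> g n"
        using g[THEN spec, of "c ` F"] by blast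
      have "x \<in> X closure_of (\<Union>(\<V> n))" if x: "x \<in> F" for x
      proof -
        \<comment> \<open>At this \<open>n\<close> the selection includes the initial segment whose
          closure contains the whole piece \<open>H (c x)\<close>.\<close>
        have "(\<Union>m\<le>f (c x) n. U n m) \<subseteq> \<Union>(\<V> n)"
          using n[OF x] unfolding \<V>_def by force
        from closure_of_mono[OF this] show ?thesis
          using c[OF x] f[of "c x" n] by blast
      qed
      then show ?thesis by blast
    qed
    moreover have "\<forall>n. finite (\<V> n) \<and> \<V> n \<subseteq> \<U> n"
      using U_in unfolding \<V>_def by auto
    ultimately show "\<exists>\<V>. (\<forall>n. finite (\<V> n) \<and> \<V> n \<subseteq> \<U> n) \<and>
        (\<forall>F. finite F \<and> F \<subseteq> topspace X \<longrightarrow> (\<exists>n. F \<subseteq> X closure_of (\<Union>(\<V> n))))"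
      by blast
  qed
qed

end
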